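(* Let $(M,\mathcal{T})$, $\mathcal{T}=(V,E,F)$, be an infinitely triangulated surface with a PH metric $d_0$ and with vertex degrees uniformly bounded by a constant $D$. Let $\epsilon>0$. Suppose $u(t)$ and $v(t)$, $t\ge0$, are two solutions to the extended hyperbolic combinatorial Yamabe flow $$\frac{du_i}{dt}=-\widetilde K_i(u(t))\qquad(i\in V,\ t\ge0)$$ satisfying $$u-v\in L^1([0,T);\ell^1(V))\quad\text{for all }T>0$$ and $$\|u(0)-v(0)\|_{\ell^2(V)}<\epsilon.$$ Then $\|u(t)-v(t)\|_{\ell^2(V)}<\epsilon$ holds for all $t\ge0$.
   Context: Infinitely triangulated surface: $M$ is a surface and $\mathcal{T}=(V,E,F)$ is a locally finite triangulation of $M$ without boundary, with vertex set $V$ infinite (countable, vertices labelled by natural numbers), edge set $E$ and face set $F$. An edge is written $\{ij\}$, a face $\triangle ijk$; the degree of $i$ is the number of edges incident to $i$. PH (piecewise hyperbolic) metric: a function $d:E\to(0,\infty)$ such that for each face $\triangle ijk\in F$ the numbers $d_{ij},d_{ik},d_{jk}$ satisfy the strict triangle inequalities, so that they are the side lengths of a nondegenerate hyperbolic triangle (curvature $-1$). Hyperbolic vertex scaling: for $u:V\to\mathbb{R}$, $u*d_0:E\to(0,\infty)$ is defined by $\sinh\frac{(u*d_0)_{ij}}{2}=e^{\frac{u_i+u_j}{2}}\sinh\frac{(d_0)_{ij}}{2}$. Extended angles: for $u:V\to\mathbb{R}$, a face $\triangle ijk\in F$ and $d=u*d_0$, set $\widetilde\theta_i^{jk}(u)$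 to be the interior angle at $i$ of the hyperbolic triangle with side lengths $d_{ij},d_{ik},d_{jk}$ if these satisfy the strict triangle inequalities; $\widetilde\theta_i^{jk}(u)=\pi$ if $d_{jk}\ge d_{ij}+d_{ik}$; and $\widetilde\theta_i^{jk}(u)=0$ if $d_{ik}\ge d_{ij}+d_{jk}$ or $d_{ij}\ge d_{ik}+d_{jk}$. (At most one triangle inequality can fail, and $\widetilde\theta_i^{jk}$ is a continuous function of $(u_i,u_j,u_k)\in\mathbb{R}^3$.) The generalized combinatorial curvature, defined for every $u:V\to\mathbb{R}$, is $\widetilde K_i(u)=2\pi-\sum_{\triangle ijk\in F}\widetilde\theta_i^{jk}(u)$ (sum over faces containing $i$). A solution is a function $u:V\times[0,\infty)\to\mathbb{R}$ with each $t\mapsto u_i(t)$ of class $C^1$ satisfying the equations. Here $\|w\|_{\ell^p(V)}=\left(\sum_{i\in V}|w_i|^p\right)^{1/p}$, and $L^1([0,T);\ell^1(V))$ is the space of functions $f:[0,T)\times V\to\mathbb{R}$ with $\int_0^T\|f(t,\cdot)\|_{\ell^1(V)}\,dt<\infty$. *)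

theory Defs
  imports "HOL-Analysis.Analysis"
begin

definition surface :: "'m topology \<Rightarrow> bool" where
  "surface M \<longleftrightarrow> Hausdorff_space M \<and> second_countable M \<and>
     (\<forall>x\<in>topspace M. \<exists>U (W :: (real^2) set). openin M U \<and> x \<in> U \<and> open W \<and>
        subtopology M U homeomorphic_space top_of_set W)"

definition simplices :: "nat set \<Rightarrow> nat set set \<Rightarrow> nat set set \<Rightarrow> nat set set" where
  "simplices V E F = (\<lambda>i. {i}) ` V \<union> E \<union> F"

definition simplicial_complex2 :: "nat set \<Rightarrow> nat set set \<Rightarrow> nat set set \<Rightarrow> bool" where
  "simplicial_complex2 V E F \<longleftrightarrow>
     (\<forall>e\<in>E. e \<subseteq> V \<and> card e = 2) \<and>
     (\<forall>f\<in>F. f \<subseteq> V \<and> card f = 3 \<and> (\<forall>e. e \<subseteq> f \<and> card e = 2 \<longrightarrow> e \<in> E))"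

definition locally_finite_complex :: "nat set \<Rightarrow> nat set set \<Rightarrow> nat set set \<Rightarrow> bool" where
  "locally_finite_complex V E F \<longleftrightarrow> (\<forall>i\<in>V. finite {s \<in> simplices V E F. i \<in> s})"

(* Points are given by their barycentric coordinates.  The topology used on this set is that of
   pointwise convergence of the coordinates; on a locally finite complex it coincides with the
   weak topology. *)
definition realization :: "nat set \<Rightarrow> nat set set \<Rightarrow> nat set set \<Rightarrow> (nat \<Rightarrow> real) set" where
  "realization V E F =
     {x. (\<forall>i. x i \<ge> 0) \<and> {i. x i \<noteq> 0} \<in> simplices V E F \<and> (\<Sum>i | x i \<noteq> 0. x i) = 1}"

definition triangulation ::
  "'m topology \<Rightarrow> nat set \<Rightarrow> nat set set \<Rightarrow> nat set set \<Rightarrow> bool" where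
  "triangulation M V E F \<longleftrightarrow> simplicial_complex2 V E F \<and> locally_finite_complex V E F \<and>
     subtopology (product_topology (\<lambda>_. euclideanreal) UNIV) (realization V E F)
       homeomorphic_space M"

definition infinitely_triangulated_surface ::
  "'m topology \<Rightarrow> nat set \<Rightarrow> nat set set \<Rightarrow> nat set set \<Rightarrow> bool" where
  "infinitely_triangulated_surface M V E F \<longleftrightarrow>
     surface M \<and> triangulation M V E F \<and> infinite V"

definition vertex_degree :: "nat set set \<Rightarrow> nat \<Rightarrow> nat" where
  "vertex_degree E i = card {e \<in> E. i \<in> e}"

text \<open>The hyperbolic plane is modelled by the upper sheet of the hyperboloid.\<close>

fun lorentz :: "real \<times> real \<times> real \<Rightarrow> real \<times> real \<times> real \<Rightarrow> real" where
  "lorentz (t, x, y) (t', x', y') = x * x' + y * y' - t * t'"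

definition hyp_plane :: "(real \<times> real \<times> real) set" where
  "hyp_plane = {p. lorentz p p = -1 \<and> fst p > 0}"

definition hyp_dist :: "real \<times> real \<times> real \<Rightarrow> real \<times> real \<times> real \<Rightarrow> real" where
  "hyp_dist p q = arcosh (- lorentz p q)"

(* The Lorentz-orthogonal projection of q to the tangent plane at p; it points in the direction
   of the geodesic from p to q. *)
definition hyp_dir :: "real \<times> real \<times> real \<Rightarrow> real \<times> real \<times> real \<Rightarrow> real \<times> real \<times> real" where
  "hyp_dir p q = q + lorentz p q *\<^sub>R p"

definition hyp_angle_at ::
  "real \<times> real \<times> real \<Rightarrow> real \<times> real \<times> real \<Rightarrow> real \<times> real \<times> real \<Rightarrow> real" where
  "hyp_angle_at p q r =
     arccos (lorentz (hyp_dir p q) (hyp_dir p r) /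
       (sqrt (lorentz (hyp_dir p q) (hyp_dir p q)) * sqrt (lorentz (hyp_dir p r) (hyp_dir p r))))"

definition strict_triangle :: "real \<Rightarrow> real \<Rightarrow> real \<Rightarrow> bool" where
  "strict_triangle a b c \<longleftrightarrow> a < b + c \<and> b < a + c \<and> c < a + b"

(* The interior angle opposite to the side of length a. *)
definition hyp_angle :: "real \<Rightarrow> real \<Rightarrow> real \<Rightarrow> real" where
  "hyp_angle a b c =
     (THE \<theta>. \<exists>p\<in>hyp_plane. \<exists>q\<in>hyp_plane. \<exists>r\<in>hyp_plane.
        hyp_dist q r = a \<and> hyp_dist p r = b \<and> hyp_dist p q = c \<and> \<theta> = hyp_angle_at p q r)"

lemma lorentz_hyp_plane_le:
  assumes "p \<in> hyp_plane" "q \<in> hyp_plane"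
  shows "- lorentz p q \<ge> 1"
proof -
  obtain t x y where p: "p = (t, x, y)" by (cases p)
  obtain t' x' y' where q: "q = (t', x', y')" by (cases q)
  have t: "t > 0" "t\<^sup>2 = 1 + x\<^sup>2 + y\<^sup>2" and t': "t' > 0" "t'\<^sup>2 = 1 + x'\<^sup>2 + y'\<^sup>2"
    using assms by (auto simp: p q hyp_plane_def power2_eq_square)
  have "(1 + x * x' + y * y')\<^sup>2 + ((x - x')\<^sup>2 + (y - y')\<^sup>2 + (x * y' - y * x')\<^sup>2)
      = (1 + x\<^sup>2 + y\<^sup>2) * (1 + x'\<^sup>2 + y'\<^sup>2)"
    by (simp add: power2_eq_square algebra_simps)
  also have "\<dots> = (t * t')\<^sup>2"
    using t t' by (simp add: power_mult_distrib)
  finally have eq: "(1 + x * x' + y * y')\<^sup>2 + ((x - x')\<^sup>2 + (y - y')\<^sup>2 + (x * y' - y * x')\<^sup>2)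
      = (t * t')\<^sup>2" .
  have "0 \<le> (x - x')\<^sup>2 + (y - y')\<^sup>2 + (x * y' - y * x')\<^sup>2"
    by (intro add_nonneg_nonneg zero_le_power2)
  then have "(1 + x * x' + y * y')\<^sup>2 \<le> (t * t')\<^sup>2" using eq by linarith
  moreover have "0 \<le> t * t'" using t(1) t'(1) by simp
  ultimately have "1 + x * x' + y * y' \<le> t * t'" by (rule power2_le_imp_le)
  then show ?thesis by (simp add: p q)
qed

lemma lorentz_commute: "lorentz p q = lorentz q p"
  by (cases p; cases q) (simp add: algebra_simps)

lemma lorentz_hyp_dir:
  assumes "p \<in> hyp_plane"
  shows "lorentz (hyp_dir p q) (hyp_dir p r) = lorentz q r + lorentz p q * lorentz p r"
proof -
  obtain t x y where p: "p = (t, x, y)" by (cases p)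
  obtain t1 x1 y1 where q: "q = (t1, x1, y1)" by (cases q)
  obtain t2 x2 y2 where r: "r = (t2, x2, y2)" by (cases r)
  have pp: "lorentz p p = -1" using assms by (simp add: hyp_plane_def)
  have "lorentz (q + A *\<^sub>R p) (r + B *\<^sub>R p)
      = lorentz q r + A * lorentz p r + B * lorentz p q + A * B * lorentz p p" for A B
    by (simp add: p q r algebra_simps)
  from this[of "lorentz p q" "lorentz p r"] show ?thesis
    unfolding hyp_dir_def pp by (simp add: mult.commute)
qed

lemma hyp_angle_at_eq:
  assumes "p \<in> hyp_plane" "q \<in> hyp_plane" "r \<in> hyp_plane"
    and "hyp_dist q r = a" "hyp_dist p r = b" "hyp_dist p q = c"
  shows "hyp_angle_at p q r = arccos ((cosh b * cosh c - cosh a) / (sinh b * sinh c))"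
proof -
  have *: "lorentz v w = - cosh (hyp_dist v w)" "hyp_dist v w \<ge> 0"
    if "v \<in> hyp_plane" "w \<in> hyp_plane" for v w
    using lorentz_hyp_plane_le[OF that] by (auto simp: hyp_dist_def)
  have n: "lorentz q q = -1" "lorentz r r = -1" using assms by (auto simp: hyp_plane_def)
  have s: "sqrt (lorentz (hyp_dir p w) (hyp_dir p w)) = sinh (hyp_dist p w)"
    if "w \<in> hyp_plane" for w
  proof -
    have "lorentz (hyp_dir p w) (hyp_dir p w) = (sinh (hyp_dist p w))\<^sup>2"
      using that lorentz_hyp_dir[OF assms(1), of w w] *(1)[OF assms(1) that]
      by (simp add: hyp_plane_def power2_eq_square[symmetric] sinh_square_eq)
    then show ?thesis using *(2)[OF assms(1) that] by simp
  qed
  show ?thesis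
    unfolding hyp_angle_at_def s[OF assms(2)] s[OF assms(3)]
    using assms by (simp add: lorentz_hyp_dir * mult.commute)
qed

lemma hyp_angle_cosine_law:
  assumes "strict_triangle a b c"
  shows "hyp_angle a b c = arccos ((cosh b * cosh c - cosh a) / (sinh b * sinh c))"
proof -
  have tri: "a < b + c" "b < a + c" "c < a + b" and pos: "a > 0" "b > 0" "c > 0"
    using assms by (auto simp: strict_triangle_def)
  define X where "X = (cosh b * cosh c - cosh a) / (sinh b * sinh c)"
  have ss: "sinh b * sinh c > 0" using pos by simp
  have "cosh a < cosh (b + c)"
    using tri pos by (subst cosh_real_nonneg_less_iff) auto
  then have "cosh b * cosh c - cosh a > - (sinh b * sinh c)" by (simp add: cosh_add)
  then have X1: "X > -1" using ss by (simp add: X_def field_simps)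
  have "cosh \<bar>b - c\<bar> < cosh a"
    using tri pos by (subst cosh_real_nonneg_less_iff) auto
  then have "cosh (b - c) < cosh a" by (simp add: abs_if split: if_splits) (metis cosh_minus minus_diff_eq)
  then have "cosh b * cosh c - cosh a < sinh b * sinh c" by (simp add: cosh_diff)
  then have X2: "X < 1" using ss by (simp add: X_def field_simps)
  define \<alpha> where "\<alpha> = arccos X"
  have cos: "cos \<alpha> = X" using X1 X2 by (simp add: \<alpha>_def)
  define p q r :: "real \<times> real \<times> real"
    where "p = (1, 0, 0)" and "q = (cosh c, sinh c, 0)"
      and "r = (cosh b, sinh b * cos \<alpha>, sinh b * sin \<alpha>)"
  have "(sinh b * cos \<alpha>)\<^sup>2 + (sinh b * sin \<alpha>)\<^sup>2 = (sinh b)\<^sup>2 * ((sin \<alpha>)\<^sup>2 + (cos \<alpha>)\<^sup>2)"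
    by (simp only: power_mult_distrib distrib_left add.commute)
  then have r2: "(sinh b * cos \<alpha>)\<^sup>2 + (sinh b * sin \<alpha>)\<^sup>2 = (sinh b)\<^sup>2"
    by (simp only: sin_cos_squared_add mult_1_right)
  have mem: "p \<in> hyp_plane" "q \<in> hyp_plane" "r \<in> hyp_plane"
    using sinh_square_eq[of b] sinh_square_eq[of c] r2
    by (auto simp: p_def q_def r_def hyp_plane_def power2_eq_square)
  have "lorentz q r = - cosh a"
    using pos by (simp add: q_def r_def cos X_def)
  then have d: "hyp_dist q r = a" "hyp_dist p r = b" "hyp_dist p q = c"
    using pos by (auto simp: hyp_dist_def p_def q_def r_def arcosh_cosh_real)
  show ?thesis
    unfolding hyp_angle_def
  proof (rule the_equality)
    show "\<exists>p\<in>hyp_plane. \<exists>q\<in>hyp_plane. \<exists>r\<in>hyp_plane.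
        hyp_dist q r = a \<and> hyp_dist p r = b \<and> hyp_dist p q = c \<and>
        arccos ((cosh b * cosh c - cosh a) / (sinh b * sinh c)) = hyp_angle_at p q r"
      using mem d hyp_angle_at_eq[OF mem d] by metis
  qed (auto simp: hyp_angle_at_eq)
qed

definition ext_angle :: "real \<Rightarrow> real \<Rightarrow> real \<Rightarrow> real" where
  "ext_angle a b c =
     (if strict_triangle a b c then hyp_angle a b c
      else if a \<ge> b + c then pi
      else 0)"

definition PH_metric :: "nat set set \<Rightarrow> nat set set \<Rightarrow> (nat set \<Rightarrow> real) \<Rightarrow> bool" where
  "PH_metric E F d \<longleftrightarrow> (\<forall>e\<in>E. d e > 0) \<and>
     (\<forall>i j k. {i, j, k} \<in> F \<longrightarrow> strict_triangle (d {j, k}) (d {i, k}) (d {i, j}))"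

definition vertex_scaling :: "(nat \<Rightarrow> real) \<Rightarrow> (nat set \<Rightarrow> real) \<Rightarrow> nat set \<Rightarrow> real" where
  "vertex_scaling u d e = 2 * arsinh (exp ((\<Sum>i\<in>e. u i) / 2) * sinh (d e / 2))"

lemma sinh_vertex_scaling:
  assumes "i \<noteq> j"
  shows "sinh (vertex_scaling u d {i, j} / 2) = exp ((u i + u j) / 2) * sinh (d {i, j} / 2)"
  using assms by (simp add: vertex_scaling_def)

(* Each face containing i is counted once, as {i, j, k} with j < k. *)
definition ext_curvature ::
  "nat set set \<Rightarrow> (nat set \<Rightarrow> real) \<Rightarrow> (nat \<Rightarrow> real) \<Rightarrow> nat \<Rightarrow> real" where
  "ext_curvature F d\<^sub>0 u i =
     (let d = vertex_scaling u d\<^sub>0 in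
      2 * pi - (\<Sum>(j, k) | j < k \<and> {i, j, k} \<in> F. ext_angle (d {j, k}) (d {i, k}) (d {i, j})))"

definition ext_flow_solution ::
  "nat set \<Rightarrow> nat set set \<Rightarrow> (nat set \<Rightarrow> real) \<Rightarrow> (real \<Rightarrow> nat \<Rightarrow> real) \<Rightarrow> bool" where
  "ext_flow_solution V F d\<^sub>0 u \<longleftrightarrow>
     (\<forall>i\<in>V. continuous_on {0..} (\<lambda>t. - ext_curvature F d\<^sub>0 (u t) i) \<and>
        (\<forall>t\<ge>0. ((\<lambda>t. u t i) has_real_derivative - ext_curvature F d\<^sub>0 (u t) i)
                  (at t within {0..})))"

(* Takes the value infinity if w is not in the space l^p. *)
definition lp_norm :: "real \<Rightarrow> nat set \<Rightarrow> (nat \<Rightarrow> real) \<Rightarrow> ennreal" where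
  "lp_norm p V w =
     (let S = (\<Sum>\<^sub>\<infinity>i\<in>V. ennreal (\<bar>w i\<bar> powr p))
      in if S = \<infinity> then \<infinity> else ennreal (enn2real S powr (1 / p)))"

(* Measurability in t is not required here; it is automatic for functions f that are continuous
   in t on [0, T) for each vertex, such as differences of solutions. *)
definition in_L1_l1 :: "real \<Rightarrow> nat set \<Rightarrow> (real \<Rightarrow> nat \<Rightarrow> real) \<Rightarrow> bool" where
  "in_L1_l1 T V f \<longleftrightarrow> (\<integral>\<^sup>+t\<in>{0..<T}. lp_norm 1 V (f t) \<partial>lborel) < \<infinity>"

end

(*
  Put a = sinh^2(l/2) for each side length l of a triangle; vertex scaling multiplies a by
  exp (u i + u j).  In these coordinates the cosine law becomes rational up to one square root, and
  the extended angle is the arccosine of this cosine clamped to [-1, 1].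

  Face monotonicity: along the segment from v to u, the sum phi of w i * theta i over the corners of
  a face, where w = u - v, is nonincreasing.  Where the triangle is nondegenerate, phi' is a
  quadratic form in w that is nonpositive by Sylvester's criterion; where it is degenerate, all
  angles lie in {0, pi}, so phi takes only finitely many values there.

  Energy estimate: for a finite vertex set A, differentiate the sum of (w i)^2 over A.  Faces inside
  A contribute nonpositive terms, and the others at most a constant times the sum of |w i| over the
  boundary of A.  The L^1(l^1) hypothesis makes the time integral of the boundary term vanish as A
  exhausts V, so every finite partial sum at time t is at most the squared l^2 norm at time 0.
*)
theory Submission
  imports Defs
begin

section \<open>Angles in half-chord coordinates\<close>

text \<open>A quarter of the determinant of the matrix of hyperbolic cosines of the distances between the
  vertices, where \<open>a = sinh\<^sup>2 (l / 2)\<close>; it is positive exactly when the strict triangle inequalities hold.\<close>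

definition gram :: "real \<Rightarrow> real \<Rightarrow> real \<Rightarrow> real" where
  "gram a b c = 2 * (a * b + b * c + a * c) - a\<^sup>2 - b\<^sup>2 - c\<^sup>2 + 4 * a * b * c"

text \<open>The hyperbolic law of cosines for the angle opposite the first side, after substituting
  \<open>cosh l = 1 + 2 * a\<close> and \<open>sinh l = 2 * sqrt (a * (1 + a))\<close> for each side
  length \<open>l\<close>.\<close>

definition chord_cos :: "real \<Rightarrow> real \<Rightarrow> real \<Rightarrow> real" where
  "chord_cos a b c = (b + c + 2 * b * c - a) / (2 * sqrt (b * (1 + b) * (c * (1 + c))))"

definition chord_angle :: "real \<Rightarrow> real \<Rightarrow> real \<Rightarrow> real" where
  "chord_angle a b c = arccos (max (-1) (min 1 (chord_cos a b c)))"

lemma gram_commute: "gram b a c = gram a b c" "gram a c b = gram a b c"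
  by (simp_all add: gram_def algebra_simps)

lemma chord_angle_commute: "chord_angle a b c = chord_angle a c b"
  by (simp add: chord_angle_def chord_cos_def algebra_simps)

text \<open>The numerator of \<open>chord_cos\<close> is a quadratic whose square differs from the
  squared denominator by exactly \<open>gram\<close>. Since \<open>gram\<close> is symmetric, all
  three corners degenerate together, and it also supplies the square root in the derivative of the
  arccosine.\<close>

lemma one_minus_chord_cos_square:
  assumes "b > 0" "c > 0"
  shows "1 - (chord_cos a b c)\<^sup>2 = gram a b c / (4 * (b * (1 + b) * (c * (1 + c))))"
proof -
  have "b * (1 + b) * (c * (1 + c)) > 0" using assms by simp
  then have "(chord_cos a b c)\<^sup>2 = (b + c + 2 * b * c - a)\<^sup>2 / (4 * (b * (1 + b) * (c * (1 + c))))"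
    unfolding chord_cos_def power_divide power_mult_distrib by simp
  moreover have "gram a b c = 4 * (b * (1 + b) * (c * (1 + c))) - (b + c + 2 * b * c - a)\<^sup>2"
    by (simp add: gram_def power2_eq_square algebra_simps)
  ultimately show ?thesis using assms by (simp add: diff_divide_distrib)
qed

lemma gram_pos_iff:
  assumes "b > 0" "c > 0"
  shows "gram a b c > 0 \<longleftrightarrow> \<bar>chord_cos a b c\<bar> < 1"
proof -
  have "0 < 4 * (b * (1 + b) * (c * (1 + c)))" using assms by simp
  then have "gram a b c > 0 \<longleftrightarrow> 1 - (chord_cos a b c)\<^sup>2 > 0"
    unfolding one_minus_chord_cos_square[OF assms] using zero_less_divide_iff by fastforce
  then show ?thesis by (simp add: abs_square_less_1)
qed

lemma chord_angle_degenerate: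
  assumes "b > 0" "c > 0" "gram a b c \<le> 0"
  shows "chord_angle a b c \<in> {0, pi}"
proof -
  have "\<bar>chord_cos a b c\<bar> \<ge> 1" using gram_pos_iff[OF assms(1,2), of a] assms(3) by linarith
  then have "max (-1) (min 1 (chord_cos a b c)) \<in> {-1, 1}" by (auto simp: max_def min_def abs_if split: if_splits)
  then show ?thesis by (auto simp: chord_angle_def)
qed

lemma chord_angle_bounds: "0 \<le> chord_angle a b c" "chord_angle a b c \<le> pi"
  unfolding chord_angle_def by (auto intro!: arccos_lbound arccos_ubound)

text \<open>By the addition formulas for \<open>cosh\<close>, the cosine is at most -1 exactly when
  \<open>b + c \<le> a\<close>, and at least 1 exactly when
  \<open>a \<le> \<bar>b - c\<bar>\<close>. Clamping therefore produces the values pi and 0 of the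
  extended angle in precisely the right degenerate cases.\<close>

lemma ext_angle_eq_chord_angle:
  assumes "a > 0" "b > 0" "c > 0"
  shows "ext_angle a b c = chord_angle ((sinh (a/2))\<^sup>2) ((sinh (b/2))\<^sup>2) ((sinh (c/2))\<^sup>2)"
proof -
  define X where "X = (cosh b * cosh c - cosh a) / (sinh b * sinh c)"
  have ch: "cosh x = 1 + 2 * (sinh (x/2))\<^sup>2" for x :: real
    using cosh_double[of "x/2"] cosh_square_eq[of "x/2"] by simp
  have sh: "sinh x = 2 * sqrt ((sinh (x/2))\<^sup>2 * (1 + (sinh (x/2))\<^sup>2))" if "x > 0" for x :: real
  proof -
    have "(sinh (x/2))\<^sup>2 * (1 + (sinh (x/2))\<^sup>2) = (sinh (x/2) * cosh (x/2))\<^sup>2"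
      using cosh_square_eq[of "x/2"] by (simp add: power_mult_distrib)
    moreover have "sinh (x/2) * cosh (x/2) \<ge> 0" using that by simp
    ultimately show ?thesis using sinh_double[of "x/2"] by simp
  qed
  have X: "X = chord_cos ((sinh (a/2))\<^sup>2) ((sinh (b/2))\<^sup>2) ((sinh (c/2))\<^sup>2)"
  proof -
    define A B C where "A = (sinh (a/2))\<^sup>2" and "B = (sinh (b/2))\<^sup>2" and "C = (sinh (c/2))\<^sup>2"
    have n: "cosh b * cosh c - cosh a = 2 * (B + C + 2 * B * C - A)"
      unfolding ch A_def B_def C_def by (simp add: algebra_simps)
    have "sinh b * sinh c = 2 * (2 * sqrt (B * (1 + B) * (C * (1 + C))))"
      unfolding sh[OF assms(2)] sh[OF assms(3)] B_def C_def by (simp only: real_sqrt_mult)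
    then show ?thesis
      unfolding X_def chord_cos_def A_def[symmetric] B_def[symmetric] C_def[symmetric] n
      by (simp only: mult_divide_mult_cancel_left_if) simp
  qed
  have ss: "sinh b * sinh c > 0" using assms by simp
  have le: "cosh x \<le> cosh y \<longleftrightarrow> x \<le> y" if "x \<ge> 0" "y \<ge> 0" for x y :: real
    using that by (rule cosh_real_nonneg_le_iff)
  have m: "X \<le> -1 \<longleftrightarrow> b + c \<le> a"
  proof -
    have "X \<le> -1 \<longleftrightarrow> cosh (b + c) \<le> cosh a"
      using ss unfolding X_def by (simp add: cosh_add pos_divide_le_eq) linarith
    then show ?thesis using assms le[of "b + c" a] by simp
  qed
  have p: "X \<ge> 1 \<longleftrightarrow> a \<le> \<bar>b - c\<bar>"
  proof -
    have "X \<ge> 1 \<longleftrightarrow> cosh a \<le> cosh (b - c)"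
      using ss unfolding X_def by (simp add: cosh_diff pos_le_divide_eq) linarith
    also have "cosh (b - c) = cosh \<bar>b - c\<bar>" using cosh_minus[of "b - c"] by (simp add: abs_if)
    finally show ?thesis using assms le[of a "\<bar>b - c\<bar>"] by simp
  qed
  show ?thesis
  proof (cases "strict_triangle a b c")
    case True
    then have "-1 < X" "X < 1" using m p by (auto simp: strict_triangle_def not_le[symmetric])
    then have "chord_angle ((sinh (a/2))\<^sup>2) ((sinh (b/2))\<^sup>2) ((sinh (c/2))\<^sup>2) = arccos X"
      by (simp add: chord_angle_def X[symmetric])
    then show ?thesis using True hyp_angle_cosine_law[OF True] by (simp add: ext_angle_def X_def)
  next
    case False
    show ?thesis
    proof (cases "a \<ge> b + c")
      case True
      then show ?thesis using False m by (simp add: ext_angle_def chord_angle_def X[symmetric])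
    next
      case F2: False
      then have "X \<ge> 1" using False p by (auto simp: strict_triangle_def)
      then show ?thesis using False F2 by (simp add: ext_angle_def chord_angle_def X[symmetric])
    qed
  qed
qed

lemma has_derivative_arccos_clamp:
  assumes "\<bar>x\<bar> < (1::real)"
  shows "((\<lambda>x. arccos (max (-1) (min 1 x))) has_real_derivative - inverse (sqrt (1 - x\<^sup>2))) (at x)"
proof (rule has_field_derivative_transform_within_open)
  show "(arccos has_real_derivative - inverse (sqrt (1 - x\<^sup>2))) (at x)"
    using assms by (auto intro!: derivative_eq_intros)
  show "open {-1<..<1::real}" by simp
qed (use assms in auto)

text \<open>The hypotheses prescribe logarithmic derivatives \<open>x\<close>, \<open>y\<close>,
  \<open>z\<close> because vertex scaling acts multiplicatively. The denominator
  \<open>sqrt (gram ...)\<close> is the same at all three corners, so the three derivatives can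
  later be added over it.\<close>

lemma chord_angle_derivative:
  fixes a b c :: "real \<Rightarrow> real"
  assumes d: "(a has_real_derivative x * a t) (at t)"
      "(b has_real_derivative y * b t) (at t)" "(c has_real_derivative z * c t) (at t)"
    and pos: "b t > 0" "c t > 0" and g: "gram (a t) (b t) (c t) > 0"
  shows "((\<lambda>t. chord_angle (a t) (b t) (c t)) has_real_derivative
     ((b t + c t + 2 * b t * c t - a t) * (y * (1 + 2 * b t) / (1 + b t) + z * (1 + 2 * c t) / (1 + c t)) / 2
       - (y * b t + z * c t + 2 * (y + z) * b t * c t - x * a t)) / sqrt (gram (a t) (b t) (c t))) (at t)"
proof -
  define B where "B = (\<lambda>t. b t * (1 + b t) * (c t * (1 + c t)))"
  define N where "N = (\<lambda>t. b t + c t + 2 * b t * c t - a t)"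
  define R where "R = sqrt (B t)"
  define N' where "N' = y * b t + z * c t + 2 * (y + z) * b t * c t - x * a t"
  \<comment> \<open>This is the logarithmic derivative of the radicand \<open>B\<close>: each factor
    \<open>f * (1 + f)\<close> with rate \<open>w\<close> contributes
    \<open>w * (1 + 2 * f) / (1 + f)\<close>.\<close>
  define \<rho> where "\<rho> = y * (1 + 2 * b t) / (1 + b t) + z * (1 + 2 * c t) / (1 + c t)"
  have B: "B t > 0" using pos by (simp add: B_def)
  have R: "R > 0" "R\<^sup>2 = B t" using B by (simp_all add: R_def)
  have dB: "(B has_real_derivative B t * \<rho>) (at t)"
  proof -
    have *: "((\<lambda>t. f t * (1 + f t)) has_real_derivative f t * (1 + f t) * (w * (1 + 2 * f t) / (1 + f t))) (at t)"
      if "(f has_real_derivative w * f t) (at t)" "f t > 0" for f :: "real \<Rightarrow> real" and w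
    proof -
      have "f t * (1 + f t) * (w * (1 + 2 * f t) / (1 + f t)) = f t * (w * (1 + 2 * f t))"
        using that(2) by simp
      then show ?thesis by (auto intro!: derivative_eq_intros that(1) simp: algebra_simps)
    qed
    show ?thesis unfolding B_def \<rho>_def
      by (rule DERIV_cong[OF DERIV_mult[OF *[OF d(2) pos(1)] *[OF d(3) pos(2)]]]) (simp only: algebra_simps)
  qed
  have dN: "(N has_real_derivative N') (at t)"
    unfolding N_def N'_def by (auto intro!: derivative_eq_intros d simp: algebra_simps)
  have dX: "((\<lambda>t. N t / (2 * sqrt (B t))) has_real_derivative (N' - N t * \<rho> / 2) / (2 * R)) (at t)"
  proof -
    have "((\<lambda>t. N t / (2 * sqrt (B t))) has_real_derivative
       (N' * (2 * R) - N t * (2 * (B t * \<rho> * (inverse R / 2)))) / ((2 * R) * (2 * R))) (at t)"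
      using B R(1) unfolding R_def
      by (auto intro!: derivative_eq_intros dB dN)
    moreover have "(N' * (2 * R) - N t * (2 * (B t * \<rho> * (inverse R / 2)))) / ((2 * R) * (2 * R)) = (N' - N t * \<rho> / 2) / (2 * R)"
      unfolding R(2)[symmetric] using R(1) by (simp add: field_simps power2_eq_square)
    ultimately show ?thesis by simp
  qed
  have X: "N t / (2 * sqrt (B t)) = chord_cos (a t) (b t) (c t)" for t
    by (simp add: N_def B_def chord_cos_def)
  \<comment> \<open>The factor \<open>2 * R\<close> here cancels the denominator
    \<open>2 * R\<close> of the derivative of the cosine, leaving only
    \<open>sqrt (gram ...)\<close>.\<close>
  have "sqrt (1 - (chord_cos (a t) (b t) (c t))\<^sup>2) = sqrt (gram (a t) (b t) (c t)) / (2 * R)"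
    unfolding one_minus_chord_cos_square[OF pos] R_def B_def
    by (simp add: real_sqrt_divide real_sqrt_mult)
  moreover have "\<bar>chord_cos (a t) (b t) (c t)\<bar> < 1" using gram_pos_iff[OF pos] g by blast
  ultimately have "((\<lambda>t. arccos (max (-1) (min 1 (chord_cos (a t) (b t) (c t))))) has_real_derivative
     - inverse (sqrt (gram (a t) (b t) (c t)) / (2 * R)) * ((N' - N t * \<rho> / 2) / (2 * R))) (at t)"
    using DERIV_chain2[OF has_derivative_arccos_clamp dX[unfolded X]] by metis
  moreover have "- inverse (sqrt (gram (a t) (b t) (c t)) / (2 * R)) * ((N' - N t * \<rho> / 2) / (2 * R))
     = (N t * \<rho> / 2 - N') / sqrt (gram (a t) (b t) (c t))"
    using R(1) g by (simp add: field_simps)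
  ultimately show ?thesis unfolding chord_angle_def N_def \<rho>_def N'_def by (simp only:)
qed

section \<open>Sign of the quadratic form in the variation of the angles\<close>

lemma quadratic_form_nonneg:
  fixes a b c d e f x y z :: real
  assumes "a > 0" "a * b - d\<^sup>2 > 0" "a * b * c + 2 * d * e * f - a * e\<^sup>2 - b * f\<^sup>2 - c * d\<^sup>2 \<ge> 0"
  shows "a * x\<^sup>2 + b * y\<^sup>2 + c * z\<^sup>2 + 2 * d * x * y + 2 * e * y * z + 2 * f * x * z \<ge> 0"
proof -
  \<comment> \<open>Lagrange's successive completion of squares, multiplied through by the first two
    leading minors to avoid division.\<close>
  have "a * (a * b - d\<^sup>2) * (a * x\<^sup>2 + b * y\<^sup>2 + c * z\<^sup>2 + 2 * d * x * y + 2 * e * y * z + 2 * f * x * z)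
    = (a * b - d\<^sup>2) * (a * x + d * y + f * z)\<^sup>2 + ((a * b - d\<^sup>2) * y + (a * e - d * f) * z)\<^sup>2
      + a * (a * b * c + 2 * d * e * f - a * e\<^sup>2 - b * f\<^sup>2 - c * d\<^sup>2) * z\<^sup>2"
    by (simp add: power2_eq_square algebra_simps)
  also have "\<dots> \<ge> 0" using assms by (intro add_nonneg_nonneg mult_nonneg_nonneg) auto
  finally show ?thesis using mult_pos_pos[OF assms(1,2)] by (meson mult_pos_neg not_le)
qed

text \<open>The minors become visibly positive through the identity \<open>gram a b c = 4 * p * q * r - s\<^sup>2\<close>.\<close>

lemma angle_form_nonneg:
  fixes a b c x y z :: real
  assumes pos: "a > 0" "b > 0" "c > 0" and g: "gram a b c > 0"
  defines "s \<equiv> 2 + a + b + c"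
  defines "p \<equiv> 1 + a" and "q \<equiv> 1 + b" and "r \<equiv> 1 + c"
  defines "k \<equiv> gram a b c + a * s" and "l \<equiv> gram a b c + b * s" and "m \<equiv> gram a b c + c * s"
  shows "(k * p) * x\<^sup>2 + (l * q) * y\<^sup>2 + (m * r) * z\<^sup>2 + 2 * (- (a + b - c) * p * q) * x * y
     + 2 * (- (b + c - a) * q * r) * y * z + 2 * (- (a + c - b) * p * r) * x * z \<ge> 0"
proof (rule quadratic_form_nonneg)
  define G where "G = gram a b c"
  have P: "p > 0" "q > 0" "r > 0" and G: "G > 0" and s: "s > 0" using pos g by (auto simp: p_def q_def r_def s_def G_def)
  show "k * p > 0" using P G s pos by (auto simp: k_def G_def intro!: mult_pos_pos add_pos_pos)
  have "(k * p) * (l * q) - (- (a + b - c) * p * q)\<^sup>2 = p * q * G * (G + (a + b) * s + 1 + a + b)"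
    unfolding k_def l_def p_def q_def s_def G_def gram_def by algebra
  also have "\<dots> > 0" using P G s pos by (auto intro!: mult_pos_pos add_pos_pos)
  finally show "(k * p) * (l * q) - (- (a + b - c) * p * q)\<^sup>2 > 0" .
  have "k * p * (l * q) * (m * r) + 2 * (- (a + b - c) * p * q) * (- (b + c - a) * q * r) * (- (a + c - b) * p * r)
      - k * p * (- (b + c - a) * q * r)\<^sup>2 - l * q * (- (a + c - b) * p * r)\<^sup>2 - m * r * (- (a + b - c) * p * q)\<^sup>2
    = p * q * r * G\<^sup>2 * (G + (a + b + c) * s + 4 + 2 * (a + b + c))"
    unfolding k_def l_def m_def p_def q_def r_def s_def G_def gram_def by algebra
  also have "\<dots> \<ge> 0" using P G s pos by (auto intro!: mult_nonneg_nonneg add_nonneg_nonneg)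
  finally show "k * p * (l * q) * (m * r) + 2 * (- (a + b - c) * p * q) * (- (b + c - a) * q * r) * (- (a + c - b) * p * r)
      - k * p * (- (b + c - a) * q * r)\<^sup>2 - l * q * (- (a + c - b) * p * r)\<^sup>2 - m * r * (- (a + b - c) * p * q)\<^sup>2 \<ge> 0" .
qed

text \<open>If the conformal factors move at rates \<open>x\<close>, \<open>y\<close>,
  \<open>z\<close>, the sides have logarithmic rates \<open>y + z\<close>, \<open>x + z\<close>,
  \<open>x + y\<close>, and the left side is \<open>sqrt (gram a b c)\<close> times the derivative
  of the angle sum weighted by these rates. Clearing denominators with
  \<open>2 * (p * q * r)\<close> turns it into the negative of the form in
  \<open>angle_form_nonneg\<close>.\<close>

lemma angle_variation_nonpos:
  fixes a b c x y z :: real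
  assumes pos: "a > 0" "b > 0" "c > 0" and g: "gram a b c > 0"
  defines "\<alpha> \<equiv> y + z" and "\<beta> \<equiv> x + z" and "\<gamma> \<equiv> x + y"
  shows "x * ((b + c + 2 * b * c - a) * (\<beta> * (1 + 2 * b) / (1 + b) + \<gamma> * (1 + 2 * c) / (1 + c)) / 2
          - (\<beta> * b + \<gamma> * c + 2 * (\<beta> + \<gamma>) * b * c - \<alpha> * a))
     + y * ((a + c + 2 * a * c - b) * (\<alpha> * (1 + 2 * a) / (1 + a) + \<gamma> * (1 + 2 * c) / (1 + c)) / 2
          - (\<alpha> * a + \<gamma> * c + 2 * (\<alpha> + \<gamma>) * a * c - \<beta> * b))
     + z * ((a + b + 2 * a * b - c) * (\<alpha> * (1 + 2 * a) / (1 + a) + \<beta> * (1 + 2 * b) / (1 + b)) / 2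
          - (\<alpha> * a + \<beta> * b + 2 * (\<alpha> + \<beta>) * a * b - \<gamma> * c)) \<le> 0"
    (is "?L \<le> 0")
proof -
  define p q r where "p = 1 + a" and "q = 1 + b" and "r = 1 + c"
  define A B C where "A = \<alpha> * (1 + 2 * a) * q * r" and "B = \<beta> * (1 + 2 * b) * p * r" and "C = \<gamma> * (1 + 2 * c) * p * q"
  have P: "p > 0" "q > 0" "r > 0" using pos by (auto simp: p_def q_def r_def)
  have e: "\<alpha> * (1 + 2 * a) / (1 + a) = A / (p * q * r)" "\<beta> * (1 + 2 * b) / (1 + b) = B / (p * q * r)"
     "\<gamma> * (1 + 2 * c) / (1 + c) = C / (p * q * r)"
    using P unfolding A_def B_def C_def p_def[symmetric] q_def[symmetric] r_def[symmetric] by (simp_all add: field_simps)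
  have "2 * (p * q * r) * ?L = x * ((b + c + 2 * b * c - a) * (B + C)
          - 2 * (p * q * r) * (\<beta> * b + \<gamma> * c + 2 * (\<beta> + \<gamma>) * b * c - \<alpha> * a))
     + y * ((a + c + 2 * a * c - b) * (A + C)
          - 2 * (p * q * r) * (\<alpha> * a + \<gamma> * c + 2 * (\<alpha> + \<gamma>) * a * c - \<beta> * b))
     + z * ((a + b + 2 * a * b - c) * (A + B)
          - 2 * (p * q * r) * (\<alpha> * a + \<beta> * b + 2 * (\<alpha> + \<beta>) * a * b - \<gamma> * c))"
  proof -
    have *: "2 * S * (X * (N * (U / S + W / S) / 2 - Y)) = X * (N * (U + W) - 2 * S * Y)" if "S \<noteq> 0" for S X N U W Y :: real
      using that by (simp add: field_simps)
    have "p * q * r \<noteq> 0" using P by simp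
    from *[OF this] show ?thesis unfolding e distrib_left[of "2 * (p * q * r)"] by (simp only:)
  qed
  also have "\<dots> = - (((gram a b c + a * (2 + a + b + c)) * (1 + a)) * x\<^sup>2 + ((gram a b c + b * (2 + a + b + c)) * (1 + b)) * y\<^sup>2
     + ((gram a b c + c * (2 + a + b + c)) * (1 + c)) * z\<^sup>2 + 2 * (- (a + b - c) * (1 + a) * (1 + b)) * x * y
     + 2 * (- (b + c - a) * (1 + b) * (1 + c)) * y * z + 2 * (- (a + c - b) * (1 + a) * (1 + c)) * x * z)"
    unfolding gram_def A_def B_def C_def \<alpha>_def \<beta>_def \<gamma>_def p_def q_def r_def by algebra
  also have "\<dots> \<le> 0" using angle_form_nonneg[OF pos g, of x y z] by linarith
  finally have "2 * (p * q * r) * ?L \<le> 0" .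
  moreover have "2 * (p * q * r) > 0" using P by simp
  ultimately show ?thesis by (meson mult_pos_pos not_le)
qed

section \<open>Monotonicity of the angles of a face\<close>

text \<open>If \<open>f\<close> increased, it would cross some interval of values that avoids \<open>S\<close>, and its
  derivative would be nonpositive throughout that crossing.\<close>

lemma nonincreasing_off_finite_values:
  fixes f :: "real \<Rightarrow> real"
  assumes cont: "continuous_on {p..q} f" and pq: "p \<le> q" and S: "finite S"
    and der: "\<And>t. p < t \<Longrightarrow> t < q \<Longrightarrow> f t \<notin> S \<Longrightarrow> \<exists>d\<le>0. (f has_real_derivative d) (at t)"
  shows "f q \<le> f p"
proof (rule ccontr)
  assume "\<not> f q \<le> f p"
  then have lt: "f p < f q" by simp
  \<comment> \<open>Finite sets are closed, so a whole closed interval of values strictly between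
    \<open>f p\<close> and \<open>f q\<close> avoids \<open>S\<close>.\<close>
  have "open ({f p<..<f q} - S)" using S by (intro open_Diff finite_imp_closed) auto
  moreover have "{f p<..<f q} - S \<noteq> {}"
    using S lt infinite_Ioo[OF lt] by (metis Diff_eq_empty_iff finite_subset)
  ultimately obtain c\<^sub>0 e where e: "e > 0" "cball c\<^sub>0 e \<subseteq> {f p<..<f q} - S"
    by (meson all_not_in_conv open_contains_cball)
  define c c' where "c = c\<^sub>0 - e" and "c' = c\<^sub>0 + e"
  have cc: "c < c'" "{c..c'} \<subseteq> {f p<..<f q} - S"
    using e by (auto simp: c_def c'_def cball_eq_atLeastAtMost)
  then have c: "f p < c" "c' < f q" using subsetD[OF cc(2), of c] subsetD[OF cc(2), of c'] by auto
  have ivt: "\<exists>t. x \<le> t \<and> t \<le> y \<and> f t = m" if "p \<le> x" "x \<le> y" "y \<le> q" "f x \<le> m" "m \<le> f y" for x y m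
    using that by (intro IVT') (auto intro: continuous_on_subset[OF cont])
  have cl: "compact {t \<in> {x..y}. f t = m}" if "p \<le> x" "y \<le> q" for x y m
  proof -
    have "closed ({x..y} \<inter> f -` {m})"
      using that by (intro continuous_closed_preimage) (auto intro: continuous_on_subset[OF cont])
    moreover have "{t \<in> {x..y}. f t = m} = {x..y} \<inter> ({x..y} \<inter> f -` {m})" by auto
    ultimately show ?thesis by (simp only: compact_Int_closed[OF compact_Icc])
  qed
  \<comment> \<open>Take \<open>b\<close> as the first time with value \<open>c'\<close> and
    \<open>a\<close> as the last time before \<open>b\<close> with value \<open>c\<close>; by the
    intermediate value theorem \<open>f\<close> cannot leave \<open>[c, c']\<close> between
    them.\<close>
  have "{t \<in> {p..q}. f t = c'} \<noteq> {}" using ivt[of p q c'] pq c cc by fastforce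
  from compact_attains_inf[OF cl this] obtain b
    where b: "p \<le> b" "b \<le> q" "f b = c'" "\<And>t. p \<le> t \<Longrightarrow> t \<le> q \<Longrightarrow> f t = c' \<Longrightarrow> b \<le> t" by fastforce
  have "{t \<in> {p..b}. f t = c} \<noteq> {}" using ivt[of p b c] b c cc by fastforce
  from compact_attains_sup[OF cl this] obtain a
    where a: "p \<le> a" "a \<le> b" "f a = c" "\<And>t. p \<le> t \<Longrightarrow> t \<le> b \<Longrightarrow> f t = c \<Longrightarrow> t \<le> a" using b by fastforce
  have ab: "a < b" using a(2,3) b(3) cc(1) by (cases "a = b") auto
  have mid: "f t \<in> {c..c'}" if t: "a < t" "t < b" for t
  proof (rule ccontr)
    assume "f t \<notin> {c..c'}"
    then consider "f t < c" | "f t > c'" by fastforce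
    then show False
    proof cases
      case 1
      then obtain t' where "t \<le> t'" "t' \<le> b" "f t' = c" using ivt[of t b c] t a b cc by auto
      then show False using a(4)[of t'] t a(1) by auto
    next
      case 2
      then obtain t' where "p \<le> t'" "t' \<le> t" "f t' = c'" using ivt[of p t c'] t a b c cc by auto
      then show False using b(4)[of t'] t b(2) by auto
    qed
  qed
  have "f b \<le> f a"
  proof (rule DERIV_nonpos_imp_decreasing_open[where f = f])
    show "\<exists>y. (f has_real_derivative y) (at x) \<and> y \<le> 0" if "a < x" "x < b" for x
    proof -
      have "f x \<notin> S" using mid[OF that] cc(2) by blast
      then show ?thesis using der[of x] that a b by auto
    qed
  qed (use ab a b in \<open>auto intro: continuous_on_subset[OF cont]\<close>)
  then show False using a b cc by simp
qed

text \<open>Linear interpolation of the conformal factors moves the side parameters exponentially;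
  \<open>x\<close>, \<open>y\<close>, \<open>z\<close> are the total changes at the corners opposite
  \<open>a\<close>, \<open>b\<close>, \<open>c\<close>. The path may enter and leave the degenerate
  region, where no derivative is at hand, so \<open>nonincreasing_off_finite_values\<close> takes
  the place of the mean value theorem.\<close>

lemma chord_angle_monotone:
  fixes \<alpha> \<beta> \<gamma> x y z :: real
  assumes pos: "\<alpha> > 0" "\<beta> > 0" "\<gamma> > 0"
  defines "a \<equiv> \<lambda>t. \<alpha> * exp ((y + z) * t)" and "b \<equiv> \<lambda>t. \<beta> * exp ((x + z) * t)" and "c \<equiv> \<lambda>t. \<gamma> * exp ((x + y) * t)"
  shows "x * (chord_angle (a 1) (b 1) (c 1) - chord_angle (a 0) (b 0) (c 0))
       + y * (chord_angle (b 1) (a 1) (c 1) - chord_angle (b 0) (a 0) (c 0))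
       + z * (chord_angle (c 1) (a 1) (b 1) - chord_angle (c 0) (a 0) (b 0)) \<le> 0"
proof -
  define f where "f = (\<lambda>t. x * chord_angle (a t) (b t) (c t) + y * chord_angle (b t) (a t) (c t) + z * chord_angle (c t) (a t) (b t))"
  \<comment> \<open>The at most eight values that \<open>f\<close> can take when every angle is 0 or
    pi.\<close>
  define S where "S = (\<lambda>(r, s, t). x * r + y * s + z * t) ` ({0, pi} \<times> {0, pi} \<times> {0, pi})"
  have p: "a t > 0" "b t > 0" "c t > 0" for t using pos by (auto simp: a_def b_def c_def)
  have ca: "continuous_on UNIV a" "continuous_on UNIV b" "continuous_on UNIV c"
    unfolding a_def b_def c_def by (auto intro!: continuous_intros)
  have cX: "continuous_on UNIV (\<lambda>t. chord_angle (g t) (h t) (k t))"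
    if "continuous_on UNIV g" "continuous_on UNIV h" "continuous_on UNIV k"
      "\<And>t. h t > 0" "\<And>t. k t > 0" for g h k :: "real \<Rightarrow> real"
  proof -
    have *: "sqrt (h t * (1 + h t) * (k t * (1 + k t))) \<noteq> 0" for t
      using that(4)[of t] that(5)[of t] by (simp add: add_pos_pos less_imp_neq)
    show ?thesis unfolding chord_angle_def chord_cos_def
      using * by (intro continuous_on_arccos continuous_intros that(1-3)) (auto simp: max_def min_def)
  qed
  have "f 1 \<le> f 0"
  proof (rule nonincreasing_off_finite_values[where f = f and S = S])
    have "continuous_on UNIV f" unfolding f_def using p ca by (intro continuous_intros cX) auto
    then show "continuous_on {0..1} f" by (rule continuous_on_subset) simp
    show "finite S" by (simp add: S_def)
    show "\<exists>d\<le>0. (f has_real_derivative d) (at t)" if ft: "f t \<notin> S" for t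
    proof -
      \<comment> \<open>By symmetry of \<open>gram\<close>, a nonpositive value would send all three
        angles into \<open>{0, pi}\<close> at once and so put \<open>f t\<close> into
        \<open>S\<close>.\<close>
      have g: "gram (a t) (b t) (c t) > 0"
      proof (rule ccontr)
        assume "\<not> ?thesis"
        then have "gram (a t) (b t) (c t) \<le> 0" by simp
        then have "chord_angle (a t) (b t) (c t) \<in> {0, pi}" "chord_angle (b t) (a t) (c t) \<in> {0, pi}"
           "chord_angle (c t) (a t) (b t) \<in> {0, pi}"
          using p chord_angle_degenerate[of "b t" "c t" "a t"] chord_angle_degenerate[of "a t" "c t" "b t"]
            chord_angle_degenerate[of "a t" "b t" "c t"]
          by (simp_all add: gram_commute)
        then show False using ft unfolding f_def S_def by force
      qed
      have da: "(a has_real_derivative (y + z) * a t) (at t)" "(b has_real_derivative (x + z) * b t) (at t)"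
          "(c has_real_derivative (x + y) * c t) (at t)"
        unfolding a_def b_def c_def by (auto intro!: derivative_eq_intros)
      define L where "L = x * ((b t + c t + 2 * b t * c t - a t) * ((x + z) * (1 + 2 * b t) / (1 + b t) + (x + y) * (1 + 2 * c t) / (1 + c t)) / 2
          - ((x + z) * b t + (x + y) * c t + 2 * ((x + z) + (x + y)) * b t * c t - (y + z) * a t))
     + y * ((a t + c t + 2 * a t * c t - b t) * ((y + z) * (1 + 2 * a t) / (1 + a t) + (x + y) * (1 + 2 * c t) / (1 + c t)) / 2
          - ((y + z) * a t + (x + y) * c t + 2 * ((y + z) + (x + y)) * a t * c t - (x + z) * b t))
     + z * ((a t + b t + 2 * a t * b t - c t) * ((y + z) * (1 + 2 * a t) / (1 + a t) + (x + z) * (1 + 2 * b t) / (1 + b t)) / 2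
          - ((y + z) * a t + (x + z) * b t + 2 * ((y + z) + (x + z)) * a t * b t - (x + y) * c t))"
      have L: "L \<le> 0" unfolding L_def by (rule angle_variation_nonpos[OF p g])
      have "(f has_real_derivative L / sqrt (gram (a t) (b t) (c t))) (at t)"
      proof -
        have g': "gram (b t) (a t) (c t) > 0" "gram (c t) (a t) (b t) > 0" using g by (simp_all add: gram_commute)
        note D = DERIV_add[OF DERIV_add[OF
          DERIV_cmult[OF chord_angle_derivative[OF da(1) da(2) da(3) p(2) p(3) g], of x]
          DERIV_cmult[OF chord_angle_derivative[OF da(2) da(1) da(3) p(1) p(3) g'(1)], of y]]
          DERIV_cmult[OF chord_angle_derivative[OF da(3) da(1) da(2) p(1) p(2) g'(2)], of z]]
        have G: "gram (b t) (a t) (c t) = gram (a t) (b t) (c t)" "gram (c t) (a t) (b t) = gram (a t) (b t) (c t)"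
          by (simp_all add: gram_commute)
        show ?thesis unfolding f_def
          by (rule DERIV_cong[OF D]) (simp only: G L_def add_divide_distrib times_divide_eq_right)
      qed
      moreover have "L / sqrt (gram (a t) (b t) (c t)) \<le> 0" using L g by (simp add: divide_nonpos_pos)
      ultimately show ?thesis by blast
    qed
  qed simp
  then show ?thesis by (simp add: f_def algebra_simps)
qed

section \<open>From chord parameters to vertex scalings\<close>

definition corner_angle :: "(nat set \<Rightarrow> real) \<Rightarrow> (nat \<Rightarrow> real) \<Rightarrow> nat \<Rightarrow> nat \<Rightarrow> nat \<Rightarrow> real" where
  "corner_angle d\<^sub>0 u i j k = (let d = vertex_scaling u d\<^sub>0 in ext_angle (d {j, k}) (d {i, k}) (d {i, j}))"

lemma corner_angle_eq_chord_angle: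
  assumes "i \<noteq> j" "i \<noteq> k" "j \<noteq> k" "d\<^sub>0 {j, k} > 0" "d\<^sub>0 {i, k} > 0" "d\<^sub>0 {i, j} > 0"
  shows "corner_angle d\<^sub>0 u i j k = chord_angle (exp (u j + u k) * (sinh (d\<^sub>0 {j, k} / 2))\<^sup>2)
     (exp (u i + u k) * (sinh (d\<^sub>0 {i, k} / 2))\<^sup>2) (exp (u i + u j) * (sinh (d\<^sub>0 {i, j} / 2))\<^sup>2)"
proof -
  have s: "(sinh (vertex_scaling u d\<^sub>0 {x, y} / 2))\<^sup>2 = exp (u x + u y) * (sinh (d\<^sub>0 {x, y} / 2))\<^sup>2"
    if "x \<noteq> y" for x y
    unfolding sinh_vertex_scaling[OF that] power_mult_distrib
    by (simp add: exp_double[symmetric])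
  have "vertex_scaling u d\<^sub>0 e > 0" if "d\<^sub>0 e > 0" for e
    using that by (simp add: vertex_scaling_def)
  then show ?thesis unfolding corner_angle_def Let_def
    by (subst ext_angle_eq_chord_angle) (simp_all add: assms s)
qed

lemma corner_angle_monotone:
  assumes d: "i \<noteq> j" "i \<noteq> k" "j \<noteq> k" and p: "d\<^sub>0 {j, k} > 0" "d\<^sub>0 {i, k} > 0" "d\<^sub>0 {i, j} > 0"
  shows "(u i - v i) * (corner_angle d\<^sub>0 u i j k - corner_angle d\<^sub>0 v i j k)
     + (u j - v j) * (corner_angle d\<^sub>0 u j i k - corner_angle d\<^sub>0 v j i k)
     + (u k - v k) * (corner_angle d\<^sub>0 u k i j - corner_angle d\<^sub>0 v k i j) \<le> 0"
proof -
  have c: "{j, i} = {i, j}" "{k, i} = {i, k}" "{k, j} = {j, k}" by auto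
  define A B C where "A = exp (v j + v k) * (sinh (d\<^sub>0 {j, k} / 2))\<^sup>2"
    and "B = exp (v i + v k) * (sinh (d\<^sub>0 {i, k} / 2))\<^sup>2" and "C = exp (v i + v j) * (sinh (d\<^sub>0 {i, j} / 2))\<^sup>2"
  have pos: "A > 0" "B > 0" "C > 0" using p by (simp_all add: A_def B_def C_def)
  \<comment> \<open>The exponential path that starts at the parameters of \<open>v\<close> reaches
    those of \<open>u\<close> at time 1.\<close>
  have e: "exp (u x + u y) * s = exp (v x + v y) * s * exp ((u x - v x) + (u y - v y))" for x y s
    by (simp add: exp_add[symmetric] mult.commute mult.left_commute)
  have co: "u j + u i = u i + u j" "u k + u i = u i + u k" "u k + u j = u j + u k"
    "v j + v i = v i + v j" "v k + v i = v i + v k" "v k + v j = v j + v k" by auto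
  note ca = corner_angle_eq_chord_angle
  have ang: "corner_angle d\<^sub>0 v i j k = chord_angle A B C" "corner_angle d\<^sub>0 v j i k = chord_angle B A C"
    "corner_angle d\<^sub>0 v k i j = chord_angle C A B"
    using d p by (simp_all add: ca c co A_def B_def C_def chord_angle_commute)
  have ang': "corner_angle d\<^sub>0 u i j k = chord_angle (A * exp ((u j - v j) + (u k - v k))) (B * exp ((u i - v i) + (u k - v k))) (C * exp ((u i - v i) + (u j - v j)))"
    "corner_angle d\<^sub>0 u j i k = chord_angle (B * exp ((u i - v i) + (u k - v k))) (A * exp ((u j - v j) + (u k - v k))) (C * exp ((u i - v i) + (u j - v j)))"
    "corner_angle d\<^sub>0 u k i j = chord_angle (C * exp ((u i - v i) + (u j - v j))) (A * exp ((u j - v j) + (u k - v k))) (B * exp ((u i - v i) + (u k - v k)))"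
    unfolding A_def B_def C_def e[symmetric] using d p by (simp_all add: ca c co chord_angle_commute)
  show ?thesis unfolding ang ang'
    using chord_angle_monotone[OF pos, where x = "u i - v i" and y = "u j - v j" and z = "u k - v k"] by simp
qed

section \<open>Energy estimate on the complex\<close>

text \<open>Indexing by face and vertex allows sums over vertices and faces to be exchanged.
  \<open>Min\<close> and \<open>Max\<close> recover the other two vertices in the order
  \<open>j < k\<close> used by \<open>ext_curvature\<close>.\<close>

definition face_angle :: "(nat set \<Rightarrow> real) \<Rightarrow> (nat \<Rightarrow> real) \<Rightarrow> nat set \<Rightarrow> nat \<Rightarrow> real" where
  "face_angle d\<^sub>0 u f i = corner_angle d\<^sub>0 u i (Min (f - {i})) (Max (f - {i}))"

lemma face_angle_eq:
  assumes "i \<noteq> j" "i \<noteq> k" "j < k"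
  shows "face_angle d\<^sub>0 u {i, j, k} i = corner_angle d\<^sub>0 u i j k"
proof -
  have "{i, j, k} - {i} = {j, k}" using assms by auto
  then show ?thesis using assms by (simp add: face_angle_def)
qed

locale bounded_degree_ph_complex =
  fixes V :: "nat set" and E F :: "nat set set" and d\<^sub>0 :: "nat set \<Rightarrow> real" and D :: nat
  assumes complex: "simplicial_complex2 V E F"
    and locally_finite: "locally_finite_complex V E F"
    and metric: "PH_metric E F d\<^sub>0"
    and degree: "\<And>i. i \<in> V \<Longrightarrow> vertex_degree E i \<le> D"
begin

abbreviation star :: "nat \<Rightarrow> nat set set" where "star i \<equiv> {f \<in> F. i \<in> f}"

lemma face_subset: "f \<in> F \<Longrightarrow> f \<subseteq> V" and card_face: "f \<in> F \<Longrightarrow> card f = 3"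
  using complex by (auto simp: simplicial_complex2_def)

lemma edge_of_face: "f \<in> F \<Longrightarrow> i \<in> f \<Longrightarrow> j \<in> f \<Longrightarrow> i \<noteq> j \<Longrightarrow> {i, j} \<in> E"
  using complex by (auto simp: simplicial_complex2_def)

lemma finite_face: "f \<in> F \<Longrightarrow> finite f"
  using card_face by (metis card.infinite zero_neq_numeral)

lemma ordered_face:
  assumes "f \<in> F" obtains i j k where "f = {i, j, k}" "i < j" "j < k"
proof -
  obtain x y z where "f = {x, y, z}" "x \<noteq> y" "y \<noteq> z" "x \<noteq> z"
    using card_face[OF assms] by (auto simp: card_3_iff)
  moreover have "{x, y, z} = {x, z, y}" "{x, y, z} = {y, x, z}" "{x, y, z} = {y, z, x}"
     "{x, y, z} = {z, x, y}" "{x, y, z} = {z, y, x}" by auto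
  ultimately show thesis using that by (metis linorder_neqE_nat)
qed

lemma finite_star: "i \<in> V \<Longrightarrow> finite (star i)"
  using locally_finite unfolding locally_finite_complex_def simplices_def
  by (elim ballE[of _ _ i]) (auto elim: finite_subset[rotated])

text \<open>A face at \<open>i\<close> is the union of its edges at \<open>i\<close>, so the faces
  at \<open>i\<close> inject into the sets of edges at \<open>i\<close>, of which there are at most
  \<open>2 ^ D\<close>.\<close>

lemma card_star:
  assumes i: "i \<in> V" shows "card (star i) \<le> 2 ^ D"
proof -
  let ?N = "{e \<in> E. i \<in> e}"
  have fin: "finite ?N"
    using locally_finite i unfolding locally_finite_complex_def simplices_def
    by (elim ballE[of _ _ i]) (auto elim: finite_subset[rotated])
  have "f = \<Union>{e \<in> ?N. e \<subseteq> f}" if f: "f \<in> star i" for f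
  proof (intro equalityI subsetI)
    fix x assume x: "x \<in> f"
    obtain y where y: "y \<in> f" "y \<noteq> i"
      using f card_face[of f] by (auto simp: card_3_iff)
    show "x \<in> \<Union>{e \<in> ?N. e \<subseteq> f}"
    proof (cases "x = i")
      case True
      then show ?thesis using edge_of_face[of f i y] f y by auto
    next
      case False
      then show ?thesis using edge_of_face[of f i x] f x by auto
    qed
  qed auto
  then have "inj_on (\<lambda>f. {e \<in> ?N. e \<subseteq> f}) (star i)" by (metis (no_types, lifting) inj_onI)
  then have "card (star i) \<le> card (Pow ?N)"
    by (rule card_inj_on_le) (use fin in auto)
  also have "\<dots> = 2 ^ vertex_degree E i" using fin by (simp add: card_Pow vertex_degree_def)
  also have "\<dots> \<le> 2 ^ D" using degree[OF i] by (intro power_increasing) auto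
  finally show ?thesis .
qed

lemma ext_curvature_eq_sum_star:
  "ext_curvature F d\<^sub>0 u i = 2 * pi - (\<Sum>f\<in>star i. face_angle d\<^sub>0 u f i)"
proof -
  have ne: "i \<noteq> j \<and> i \<noteq> k" if "j < k" "{i, j, k} \<in> F" for j k
    using card_face[OF that(2)] by (auto simp: card_insert_if split: if_splits)
  have "(\<Sum>(j, k) | j < k \<and> {i, j, k} \<in> F. corner_angle d\<^sub>0 u i j k) = (\<Sum>f\<in>star i. face_angle d\<^sub>0 u f i)"
  proof (rule sum.reindex_bij_witness[where i = "\<lambda>f. (Min (f - {i}), Max (f - {i}))" and j = "\<lambda>(j, k). {i, j, k}"])
    fix p assume "p \<in> {(j, k). j < k \<and> {i, j, k} \<in> F}"
    then obtain j k where p: "p = (j, k)" "j < k" "{i, j, k} \<in> F" by auto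
    have m: "{i, j, k} - {i} = {j, k}" using ne[OF p(2,3)] by auto
    show "(Min ((case p of (j, k) \<Rightarrow> {i, j, k}) - {i}), Max ((case p of (j, k) \<Rightarrow> {i, j, k}) - {i})) = p"
      using p m by simp
    show "(case p of (j, k) \<Rightarrow> {i, j, k}) \<in> star i" using p by simp
    show "face_angle d\<^sub>0 u (case p of (j, k) \<Rightarrow> {i, j, k}) i = (case p of (j, k) \<Rightarrow> corner_angle d\<^sub>0 u i j k)"
      using p ne[OF p(2,3)] by (simp add: face_angle_eq)
  next
    fix f assume f: "f \<in> star i"
    then have "card (f - {i}) = 2" using card_face[of f] by simp
    then obtain j k where jk: "f - {i} = {j, k}" "j < k"
      by (metis card_2_iff insert_commute linorder_neqE_nat)
    then have f': "f = {i, j, k}" using f by auto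
    show "(case (Min (f - {i}), Max (f - {i})) of (j, k) \<Rightarrow> {i, j, k}) = f" using jk f' by simp
    show "(Min (f - {i}), Max (f - {i})) \<in> {(j, k). j < k \<and> {i, j, k} \<in> F}" using jk f f' by simp
  qed
  then show ?thesis by (simp add: ext_curvature_def corner_angle_def Let_def)
qed

lemma face_angle_monotone:
  assumes f: "f \<in> F"
  shows "(\<Sum>i\<in>f. (u i - v i) * (face_angle d\<^sub>0 u f i - face_angle d\<^sub>0 v f i)) \<le> 0"
proof -
  obtain i j k where o: "f = {i, j, k}" "i < j" "j < k" using ordered_face[OF f] .
  have "{j, k} \<in> E" "{i, k} \<in> E" "{i, j} \<in> E"
    using o by (auto intro!: edge_of_face[OF f])
  then have p: "d\<^sub>0 {j, k} > 0" "d\<^sub>0 {i, k} > 0" "d\<^sub>0 {i, j} > 0"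
    using metric unfolding PH_metric_def by auto
  have "{i, j, k} = {j, i, k}" "{i, j, k} = {k, i, j}" by auto
  then have "face_angle d\<^sub>0 w f i = corner_angle d\<^sub>0 w i j k" "face_angle d\<^sub>0 w f j = corner_angle d\<^sub>0 w j i k"
     "face_angle d\<^sub>0 w f k = corner_angle d\<^sub>0 w k i j" for w
    using o face_angle_eq[of i j k] face_angle_eq[of j i k] face_angle_eq[of k i j] by auto
  then show ?thesis
    using corner_angle_monotone[of i j k d\<^sub>0 u v] o p by (simp add: algebra_simps)
qed

lemma face_angle_bounds: "0 \<le> face_angle d\<^sub>0 u f i \<and> face_angle d\<^sub>0 u f i \<le> pi" if "f \<in> F" "i \<in> f"
proof -
  define j k where "j = Min (f - {i})" and "k = Max (f - {i})"
  have "card (f - {i}) = 2" using card_face[OF that(1)] that(2) by simp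
  then obtain x y where xy: "f - {i} = {x, y}" "x < y"
    by (metis card_2_iff insert_commute linorder_neqE_nat)
  then have "j = x" "k = y" by (simp_all add: j_def k_def)
  moreover have "x \<in> f" "y \<in> f" "x \<noteq> i" "y \<noteq> i" using xy by auto
  ultimately have "d\<^sub>0 {j, k} > 0" "d\<^sub>0 {i, k} > 0" "d\<^sub>0 {i, j} > 0" "i \<noteq> j" "i \<noteq> k" "j \<noteq> k"
    using metric edge_of_face[OF that(1)] that(2) xy(2) unfolding PH_metric_def by auto
  then show ?thesis unfolding face_angle_def j_def[symmetric] k_def[symmetric]
    by (simp add: corner_angle_eq_chord_angle chord_angle_bounds)
qed

text \<open>Exchange the sums over vertices and faces. A face inside \<open>A\<close> contributes a
  nonpositive amount by \<open>face_angle_monotone\<close>. A face that leaves \<open>A\<close>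
  misses \<open>B\<close>, so only vertices of \<open>A - B\<close> pay for it: at most pi per face,
  for at most \<open>2 ^ D\<close> faces each.\<close>

lemma energy_variation_bound:
  assumes A: "finite A" "A \<subseteq> V" and B: "B \<subseteq> A" "\<And>f. f \<in> F \<Longrightarrow> f \<inter> B \<noteq> {} \<Longrightarrow> f \<subseteq> A"
  shows "(\<Sum>i\<in>A. (u i - v i) * (\<Sum>f\<in>star i. face_angle d\<^sub>0 u f i - face_angle d\<^sub>0 v f i))
    \<le> pi * 2 ^ D * (\<Sum>i\<in>A - B. \<bar>u i - v i\<bar>)"
proof -
  define \<Delta> where "\<Delta> = (\<lambda>f i. face_angle d\<^sub>0 u f i - face_angle d\<^sub>0 v f i)"
  define S where "S = (\<Union>i\<in>A. star i)"
  have S: "finite S" "S \<subseteq> F" using A finite_star by (auto simp: S_def)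
  have star: "star i = {f \<in> S. i \<in> f}" if "i \<in> A" for i using that by (auto simp: S_def)
  have \<Delta>: "\<bar>\<Delta> f i\<bar> \<le> pi" if "f \<in> F" "i \<in> f" for f i
    using face_angle_bounds[OF that, of u] face_angle_bounds[OF that, of v] by (auto simp: \<Delta>_def)
  have "(\<Sum>i\<in>A. (u i - v i) * (\<Sum>f\<in>star i. \<Delta> f i)) = (\<Sum>i\<in>A. \<Sum>f | f \<in> S \<and> i \<in> f. (u i - v i) * \<Delta> f i)"
    by (intro sum.cong refl) (simp add: star sum_distrib_left)
  also have "\<dots> = (\<Sum>f\<in>S. \<Sum>i | i \<in> A \<and> i \<in> f. (u i - v i) * \<Delta> f i)"
    using A S by (intro sum.swap_restrict)
  also have "\<dots> \<le> (\<Sum>f\<in>S. \<Sum>i | i \<in> A - B \<and> i \<in> f. pi * \<bar>u i - v i\<bar>)"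
  proof (rule sum_mono)
    fix f assume "f \<in> S"
    then have f: "f \<in> F" using S by auto
    show "(\<Sum>i | i \<in> A \<and> i \<in> f. (u i - v i) * \<Delta> f i) \<le> (\<Sum>i | i \<in> A - B \<and> i \<in> f. pi * \<bar>u i - v i\<bar>)"
    proof (cases "f \<subseteq> A")
      case True
      then have "{i. i \<in> A \<and> i \<in> f} = f" by auto
      then have "(\<Sum>i | i \<in> A \<and> i \<in> f. (u i - v i) * \<Delta> f i) \<le> 0"
        using face_angle_monotone[OF f, of u v] by (simp add: \<Delta>_def)
      also have "0 \<le> (\<Sum>i | i \<in> A - B \<and> i \<in> f. pi * \<bar>u i - v i\<bar>)" by (intro sum_nonneg) auto
      finally show ?thesis .
    next
      case False
      then have "f \<inter> B = {}" using B(2)[OF f] by blast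
      then have e: "{i. i \<in> A \<and> i \<in> f} = {i. i \<in> A - B \<and> i \<in> f}" by auto
      have "(u i - v i) * \<Delta> f i \<le> pi * \<bar>u i - v i\<bar>" if "i \<in> f" for i
      proof -
        have "(u i - v i) * \<Delta> f i \<le> \<bar>u i - v i\<bar> * \<bar>\<Delta> f i\<bar>" by (metis abs_ge_self abs_mult)
        also have "\<dots> \<le> \<bar>u i - v i\<bar> * pi" using \<Delta>[OF f that] by (intro mult_left_mono) auto
        finally show ?thesis by (simp add: mult.commute)
      qed
      then show ?thesis unfolding e by (intro sum_mono) auto
    qed
  qed
  also have "\<dots> = (\<Sum>i\<in>A - B. \<Sum>f | f \<in> S \<and> i \<in> f. pi * \<bar>u i - v i\<bar>)"
    using A S by (intro sum.swap_restrict[symmetric]) auto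
  also have "\<dots> = (\<Sum>i\<in>A - B. real (card (star i)) * (pi * \<bar>u i - v i\<bar>))"
    by (intro sum.cong refl) (simp add: star)
  also have "\<dots> \<le> (\<Sum>i\<in>A - B. 2 ^ D * (pi * \<bar>u i - v i\<bar>))"
  proof (intro sum_mono mult_right_mono)
    fix i assume "i \<in> A - B"
    then have "card (star i) \<le> 2 ^ D" using A card_star by auto
    then have "real (card (star i)) \<le> real (2 ^ D)" by (rule of_nat_mono)
    then show "real (card (star i)) \<le> 2 ^ D" by simp
  qed auto
  finally show ?thesis by (simp add: \<Delta>_def sum_distrib_left mult_ac)
qed

lemma flow_difference_derivative:
  assumes "ext_flow_solution V F d\<^sub>0 u" "ext_flow_solution V F d\<^sub>0 v" "i \<in> V" "t \<ge> 0"
  shows "((\<lambda>t. u t i - v t i) has_real_derivative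
     (\<Sum>f\<in>star i. face_angle d\<^sub>0 (u t) f i - face_angle d\<^sub>0 (v t) f i)) (at t within {0..})"
proof -
  have "((\<lambda>t. u t i - v t i) has_real_derivative
     - ext_curvature F d\<^sub>0 (u t) i - (- ext_curvature F d\<^sub>0 (v t) i)) (at t within {0..})"
    using assms unfolding ext_flow_solution_def by (intro DERIV_diff) auto
  then show ?thesis by (simp add: ext_curvature_eq_sum_star sum_subtractf)
qed

lemma energy_estimate:
  assumes sol: "ext_flow_solution V F d\<^sub>0 u" "ext_flow_solution V F d\<^sub>0 v"
    and A: "finite A" "A \<subseteq> V" and B: "B \<subseteq> A" "\<And>f. f \<in> F \<Longrightarrow> f \<inter> B \<noteq> {} \<Longrightarrow> f \<subseteq> A"
    and T: "T \<ge> 0"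
  shows "(\<Sum>i\<in>A. (u T i - v T i)\<^sup>2) \<le> (\<Sum>i\<in>A. (u 0 i - v 0 i)\<^sup>2)
    + 2 * pi * 2 ^ D * (\<Sum>i\<in>A - B. integral {0..T} (\<lambda>t. \<bar>u t i - v t i\<bar>))"
proof -
  define w where "w = (\<lambda>i t. u t i - v t i)"
  define w' where "w' = (\<lambda>i t. \<Sum>f\<in>star i. face_angle d\<^sub>0 (u t) f i - face_angle d\<^sub>0 (v t) f i)"
  have dw: "(w i has_real_derivative w' i t) (at t within {0..T})" if "i \<in> A" "t \<in> {0..T}" for i t
    unfolding w_def w'_def
    by (rule DERIV_subset[OF flow_difference_derivative[OF sol]]) (use that A in auto)
  have cw: "continuous_on {0..T} (w i)" if "i \<in> A" for i
    using dw[OF that] by (rule DERIV_continuous_on)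
  \<comment> \<open>The energy minus its accumulated boundary bound; the factor 2 comes from
    differentiating the squares. Showing \<open>g\<close> nonincreasing amounts to integrating the
    differential inequality.\<close>
  define g where "g = (\<lambda>t. (\<Sum>i\<in>A. (w i t)\<^sup>2) - 2 * pi * 2 ^ D * (\<Sum>i\<in>A - B. integral {0..t} (\<lambda>s. \<bar>w i s\<bar>)))"
  define g' where "g' = (\<lambda>t. (\<Sum>i\<in>A. 2 * (w i t * w' i t)) - 2 * pi * 2 ^ D * (\<Sum>i\<in>A - B. \<bar>w i t\<bar>))"
  have dg: "(g has_real_derivative g' t) (at t within {0..T})" if t: "t \<in> {0..T}" for t
  proof -
    have "((\<lambda>t. integral {0..t} (\<lambda>s. \<bar>w i s\<bar>)) has_real_derivative \<bar>w i t\<bar>) (at t within {0..T})" if "i \<in> A" for i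
      by (rule integral_has_real_derivative[OF _ t]) (intro continuous_intros cw that)
    moreover have "((\<lambda>t. (w i t)\<^sup>2) has_real_derivative 2 * (w i t * w' i t)) (at t within {0..T})" if "i \<in> A" for i
      by (auto intro!: derivative_eq_intros dw[OF that t])
    ultimately show ?thesis unfolding g_def g'_def
      by (intro DERIV_diff DERIV_cmult DERIV_sum) auto
  qed
  have "g T \<le> g 0"
  proof (rule DERIV_nonpos_imp_decreasing_open[where f = g, OF T])
    fix t assume t: "0 < t" "t < T"
    have "(\<Sum>i\<in>A. w i t * w' i t) \<le> pi * 2 ^ D * (\<Sum>i\<in>A - B. \<bar>w i t\<bar>)"
      unfolding w_def w'_def by (rule energy_variation_bound[OF A B])
    then have "g' t \<le> 0" by (simp add: g'_def sum_distrib_left[symmetric])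
    moreover have "(g has_real_derivative g' t) (at t)"
      using dg[of t] t by (simp add: at_within_Icc_at)
    ultimately show "\<exists>y. (g has_real_derivative y) (at t) \<and> y \<le> 0" by blast
  qed (use dg in \<open>rule DERIV_continuous_on\<close>)
  then show ?thesis by (simp add: g_def w_def)
qed

text \<open>Provides the set \<open>A\<close> required by the energy estimate: adding to
  \<open>B\<close> all faces that meet it keeps it finite by local finiteness.\<close>

lemma finite_star_neighbourhood:
  assumes "finite B" "B \<subseteq> V"
  obtains A where "finite A" "A \<subseteq> V" "B \<subseteq> A" "\<And>f. f \<in> F \<Longrightarrow> f \<inter> B \<noteq> {} \<Longrightarrow> f \<subseteq> A"
proof
  show "finite (B \<union> (\<Union>i\<in>B. \<Union>(star i)))" using assms finite_star finite_face by auto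
  show "B \<union> (\<Union>i\<in>B. \<Union>(star i)) \<subseteq> V" using assms face_subset by auto
qed auto

end

section \<open>Passage from finite sums to the infinite vertex set\<close>

lemma small_tail_of_bounded_sums:
  fixes a :: "'a \<Rightarrow> real"
  assumes bd: "\<And>A. finite A \<Longrightarrow> A \<subseteq> V \<Longrightarrow> sum a A \<le> K" and "\<delta> > 0"
  obtains B where "finite B" "B \<subseteq> V" "\<And>X. finite X \<Longrightarrow> X \<subseteq> V - B \<Longrightarrow> sum a X < \<delta>"
proof -
  define s where "s = (SUP A\<in>{A. finite A \<and> A \<subseteq> V}. sum a A)"
  have bdd: "bdd_above (sum a ` {A. finite A \<and> A \<subseteq> V})" using bd by (auto intro!: bdd_aboveI2)
  have ne: "{A. finite A \<and> A \<subseteq> V} \<noteq> {}" by auto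
  have "s - \<delta> < s" using assms by simp
  \<comment> \<open>A finite sum within \<open>\<delta>\<close> of the supremum: adjoining a set
    disjoint from \<open>B\<close> cannot pass the supremum, so it adds less than
    \<open>\<delta>\<close>.\<close>
  then obtain B where B: "finite B" "B \<subseteq> V" "s - \<delta> < sum a B"
    unfolding s_def using less_cSUP_iff[OF ne bdd] by auto
  have "sum a X < \<delta>" if X: "finite X" "X \<subseteq> V - B" for X
  proof -
    have "sum a (B \<union> X) \<le> s" unfolding s_def using B X by (intro cSUP_upper bdd) auto
    moreover have "sum a (B \<union> X) = sum a B + sum a X" using B X by (intro sum.union_disjoint) auto
    ultimately show ?thesis using B by linarith
  qed
  then show thesis using that B by blast
qed

lemma lp_norm_1: "lp_norm 1 V w = (\<Sum>\<^sub>\<infinity>i\<in>V. ennreal \<bar>w i\<bar>)"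
  by (cases "(\<Sum>\<^sub>\<infinity>i\<in>V. ennreal \<bar>w i\<bar>) = \<infinity>") (auto simp: lp_norm_def Let_def less_top[symmetric])

lemma ennreal_sum_le_infsum:
  assumes "finite A" "A \<subseteq> V" "\<And>i. g i \<ge> 0"
  shows "ennreal (\<Sum>i\<in>A. g i) \<le> (\<Sum>\<^sub>\<infinity>i\<in>V. ennreal (g i))"
proof -
  have "ennreal (\<Sum>i\<in>A. g i) = (\<Sum>i\<in>A. ennreal (g i))" using assms(3) by (simp add: sum_ennreal)
  also have "\<dots> = (\<Sum>\<^sub>\<infinity>i\<in>A. ennreal (g i))" using assms(1) by simp
  also have "\<dots> \<le> (\<Sum>\<^sub>\<infinity>i\<in>V. ennreal (g i))"
    by (intro infsum_mono_neutral nonneg_summable_on_complete) (use assms(2) in auto)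
  finally show ?thesis .
qed

text \<open>The slack \<open>\<delta>\<close> absorbs the boundary term and tends to 0, giving a
  weak inequality between the two norms. Strictness then comes from the assumed bound on the norm of
  \<open>w\<close>.\<close>

lemma lp_norm_less_of_finite_sums:
  assumes p: "p > 0" and lt: "lp_norm p V w < ennreal \<epsilon>"
    and le: "\<And>A \<delta>. finite A \<Longrightarrow> A \<subseteq> V \<Longrightarrow> \<delta> > 0 \<Longrightarrow> \<exists>A'. finite A' \<and> A' \<subseteq> V \<and>
        (\<Sum>i\<in>A. \<bar>w' i\<bar> powr p) \<le> (\<Sum>i\<in>A'. \<bar>w i\<bar> powr p) + \<delta>"
  shows "lp_norm p V w' < ennreal \<epsilon>"
proof -
  define S S' where "S = (\<Sum>\<^sub>\<infinity>i\<in>V. ennreal (\<bar>w i\<bar> powr p))" and "S' = (\<Sum>\<^sub>\<infinity>i\<in>V. ennreal (\<bar>w' i\<bar> powr p))"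
  have "S' \<le> S" unfolding S'_def
  proof (rule infsum_le_finite_sums)
    show "(\<lambda>i. ennreal (\<bar>w' i\<bar> powr p)) summable_on V" by (rule nonneg_summable_on_complete) simp
    fix A assume A: "finite A" "A \<subseteq> V"
    show "(\<Sum>i\<in>A. ennreal (\<bar>w' i\<bar> powr p)) \<le> S"
    proof (rule ennreal_le_epsilon)
      fix \<delta> :: real assume "0 < \<delta>"
      from le[OF A this] obtain A' where A': "finite A'" "A' \<subseteq> V"
        "(\<Sum>i\<in>A. \<bar>w' i\<bar> powr p) \<le> (\<Sum>i\<in>A'. \<bar>w i\<bar> powr p) + \<delta>" by blast
      have "(\<Sum>i\<in>A. ennreal (\<bar>w' i\<bar> powr p)) = ennreal (\<Sum>i\<in>A. \<bar>w' i\<bar> powr p)" by (simp add: sum_ennreal)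
      also have "\<dots> \<le> ennreal ((\<Sum>i\<in>A'. \<bar>w i\<bar> powr p) + \<delta>)" by (rule ennreal_leI[OF A'(3)])
      also have "\<dots> = ennreal (\<Sum>i\<in>A'. \<bar>w i\<bar> powr p) + ennreal \<delta>"
        using \<open>0 < \<delta>\<close> by (intro ennreal_plus sum_nonneg) auto
      also have "\<dots> \<le> S + ennreal \<delta>" unfolding S_def
        using A' by (intro add_right_mono ennreal_sum_le_infsum) auto
      finally show "(\<Sum>i\<in>A. ennreal (\<bar>w' i\<bar> powr p)) \<le> S + ennreal \<delta>" .
    qed
  qed
  \<comment> \<open>Finiteness matters because \<open>enn2real\<close> sends infinity to 0 and is
    monotone only below infinity.\<close>
  moreover have fin: "S \<noteq> \<infinity>" using lt by (auto simp: lp_norm_def Let_def S_def[symmetric])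
  ultimately have fin': "S' \<noteq> \<infinity>" "enn2real S' \<le> enn2real S" by (auto simp: top_unique less_top intro!: enn2real_mono)
  have "lp_norm p V w' = ennreal (enn2real S' powr (1 / p))"
    using fin' by (simp add: lp_norm_def Let_def S'_def[symmetric])
  also have "\<dots> \<le> ennreal (enn2real S powr (1 / p))"
    using fin' p by (intro ennreal_leI powr_mono2) auto
  also have "\<dots> = lp_norm p V w"
    using fin by (simp add: lp_norm_def Let_def S_def[symmetric])
  finally show ?thesis using lt by simp
qed

text \<open>Each finite partial sum is pointwise at most the l^1 norm, so its integral is at most
  that of the norm. The nonnegative integral is monotone for arbitrary functions, so only the
  continuous partial sums have to be integrable. Taking \<open>T < T'\<close> places the closed
  interval inside the half-open one.\<close>

lemma L1_l1_bounded_sums: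
  assumes f: "in_L1_l1 T' V f" and T: "T < T'" and c: "\<And>i. i \<in> V \<Longrightarrow> continuous_on {0..T} (\<lambda>t. f t i)"
  obtains K where "\<And>A. finite A \<Longrightarrow> A \<subseteq> V \<Longrightarrow> (\<Sum>i\<in>A. integral {0..T} (\<lambda>t. \<bar>f t i\<bar>)) \<le> K"
proof
  define J where "J = (\<integral>\<^sup>+t\<in>{0..<T'}. lp_norm 1 V (f t) \<partial>lborel)"
  have J: "J < \<infinity>" using f by (simp add: in_L1_l1_def J_def)
  fix A assume A: "finite A" "A \<subseteq> V"
  define h where "h = (\<lambda>t. \<Sum>i\<in>A. \<bar>f t i\<bar>)"
  have ch: "continuous_on {0..T} h" unfolding h_def using A c by (intro continuous_intros) auto
  have h0: "h t \<ge> 0" for t by (auto simp: h_def intro: sum_nonneg)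
  have si: "set_integrable lborel {0..T} h" by (rule borel_integrable_atLeastAtMost'[OF ch])
  have "(\<Sum>i\<in>A. integral {0..T} (\<lambda>t. \<bar>f t i\<bar>)) = integral {0..T} h"
    unfolding h_def using A c
    by (intro integral_sum[symmetric]) (auto intro!: integrable_continuous_interval continuous_intros)
  also have "\<dots> = (LINT t:{0..T}|lborel. h t)" using set_borel_integral_eq_integral(2)[OF si] by simp
  finally have "ennreal (\<Sum>i\<in>A. integral {0..T} (\<lambda>t. \<bar>f t i\<bar>)) = (\<integral>\<^sup>+t. indicator {0..T} t *\<^sub>R h t \<partial>lborel)"
    using si h0 unfolding set_lebesgue_integral_def set_integrable_def
    by (subst nn_integral_eq_integral) auto
  also have "\<dots> \<le> J" unfolding J_def
  proof (rule nn_integral_mono)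
    fix t
    have "ennreal (h t) \<le> lp_norm 1 V (f t)"
      unfolding lp_norm_1 h_def using A by (intro ennreal_sum_le_infsum) auto
    then show "ennreal (indicator {0..T} t *\<^sub>R h t) \<le> lp_norm 1 V (f t) * indicator {0..<T'} t"
      using T by (auto simp: indicator_def)
  qed
  finally have "enn2real (ennreal (\<Sum>i\<in>A. integral {0..T} (\<lambda>t. \<bar>f t i\<bar>))) \<le> enn2real J"
    using J by (intro enn2real_mono) auto
  moreover have "(\<Sum>i\<in>A. integral {0..T} (\<lambda>t. \<bar>f t i\<bar>)) \<ge> 0"
    using A c by (intro sum_nonneg integral_nonneg) (auto intro!: integrable_continuous_interval continuous_intros)
  ultimately show "(\<Sum>i\<in>A. integral {0..T} (\<lambda>t. \<bar>f t i\<bar>)) \<le> enn2real J" by simp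
qed

theorem theorem6p2:
  fixes M :: "'m topology" and V :: "nat set" and E F :: "nat set set"
    and d\<^sub>0 :: "nat set \<Rightarrow> real" and D :: nat and \<epsilon> :: real
    and u v :: "real \<Rightarrow> nat \<Rightarrow> real"
  assumes "infinitely_triangulated_surface M V E F"
    and "PH_metric E F d\<^sub>0"
    and "\<forall>i\<in>V. vertex_degree E i \<le> D"
    and "\<epsilon> > 0"
    and "ext_flow_solution V F d\<^sub>0 u"
    and "ext_flow_solution V F d\<^sub>0 v"
    and "\<forall>T>0. in_L1_l1 T V (\<lambda>t i. u t i - v t i)"
    and "lp_norm 2 V (\<lambda>i. u 0 i - v 0 i) < ennreal \<epsilon>"
  shows "\<forall>t\<ge>0. lp_norm 2 V (\<lambda>i. u t i - v t i) < ennreal \<epsilon>"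
proof (intro allI impI)
  fix T :: real assume T: "T \<ge> 0"
  interpret bounded_degree_ph_complex V E F d\<^sub>0 D
    using assms(1-3) by unfold_locales (auto simp: infinitely_triangulated_surface_def triangulation_def)
  have cont: "continuous_on {0..T} (\<lambda>t. u t i - v t i)" if "i \<in> V" for i
    by (rule DERIV_continuous_on, rule DERIV_subset[OF flow_difference_derivative[OF assms(5,6) that]]) auto
  \<comment> \<open>The extra unit of time covers the endpoint \<open>T\<close> and also the case
    \<open>T = 0\<close>.\<close>
  have "in_L1_l1 (T + 1) V (\<lambda>t i. u t i - v t i)" using assms(7) T by simp
  from L1_l1_bounded_sums[OF this _ cont] obtain K where
    K: "\<And>A. finite A \<Longrightarrow> A \<subseteq> V \<Longrightarrow> (\<Sum>i\<in>A. integral {0..T} (\<lambda>t. \<bar>u t i - v t i\<bar>)) \<le> K" by auto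
  show "lp_norm 2 V (\<lambda>i. u T i - v T i) < ennreal \<epsilon>"
  proof (rule lp_norm_less_of_finite_sums[OF _ assms(8)])
    fix A\<^sub>0 and \<delta> :: real assume A\<^sub>0: "finite A\<^sub>0" "A\<^sub>0 \<subseteq> V" and \<delta>: "\<delta> > 0"
    define C :: real where "C = 2 * pi * 2 ^ D"
    have C: "C > 0" by (simp add: C_def)
    \<comment> \<open>The tail set is fixed before \<open>A\<close>: whatever finite
      \<open>A\<close> is taken later, its boundary part avoids \<open>B\<close>, and its integral
      times the constant \<open>C\<close> of the energy estimate stays below
      \<open>\<delta>\<close>.\<close>
    obtain B where B: "finite B" "B \<subseteq> V"
      "\<And>X. finite X \<Longrightarrow> X \<subseteq> V - B \<Longrightarrow> (\<Sum>i\<in>X. integral {0..T} (\<lambda>t. \<bar>u t i - v t i\<bar>)) < \<delta> / C"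
      using small_tail_of_bounded_sums[OF K, where \<delta> = "\<delta> / C"] \<delta> C by auto
    \<comment> \<open>Including \<open>A\<^sub>0\<close> lets the energy over \<open>A\<close>
      dominate the partial sum to be bounded; including \<open>B\<close> keeps the boundary part in
      the small tail.\<close>
    obtain A where A: "finite A" "A \<subseteq> V" "A\<^sub>0 \<union> B \<subseteq> A" "\<And>f. f \<in> F \<Longrightarrow> f \<inter> (A\<^sub>0 \<union> B) \<noteq> {} \<Longrightarrow> f \<subseteq> A"
      using finite_star_neighbourhood[of "A\<^sub>0 \<union> B"] A\<^sub>0 B(1,2) by auto
    have "(\<Sum>i\<in>A\<^sub>0. (u T i - v T i)\<^sup>2) \<le> (\<Sum>i\<in>A. (u T i - v T i)\<^sup>2)"
      using A by (intro sum_mono2) auto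
    also have "\<dots> \<le> (\<Sum>i\<in>A. (u 0 i - v 0 i)\<^sup>2)
        + C * (\<Sum>i\<in>A - (A\<^sub>0 \<union> B). integral {0..T} (\<lambda>t. \<bar>u t i - v t i\<bar>))"
      unfolding C_def by (rule energy_estimate[OF assms(5,6) A T])
    also have "C * (\<Sum>i\<in>A - (A\<^sub>0 \<union> B). integral {0..T} (\<lambda>t. \<bar>u t i - v t i\<bar>)) \<le> \<delta>"
      using B(3)[of "A - (A\<^sub>0 \<union> B)"] A(1,2) C by (auto simp: pos_less_divide_eq mult.commute intro: less_imp_le)
    finally show "\<exists>A'. finite A' \<and> A' \<subseteq> V \<and>
        (\<Sum>i\<in>A\<^sub>0. \<bar>u T i - v T i\<bar> powr 2) \<le> (\<Sum>i\<in>A'. \<bar>u 0 i - v 0 i\<bar> powr 2) + \<delta>"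
      using A by (intro exI[of _ A]) simp
  qed simp
qed

end
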